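(* No von Dyck group has Borel's property. That is, for all positive integers $a,b,c$ with $\frac1a+\frac1b+\frac1c<1$, the group $$\langle x_1,x_2,x_3 : x_1^a=x_2^b=x_3^c=x_1x_2x_3=1\rangle$$ does not have Borel's property.
   Context: A group $\Gamma$ has Borel's property if for every connected semisimple linear algebraic group $G$ over $\mathbb{C}$, every proper (Zariski-closed) subvariety $V$ of $G$, and every element $\gamma\ne 1$ of infinite order in $\Gamma$, there exists a homomorphism $\phi\colon\Gamma\to G(\mathbb{C})$ such that $\phi(\gamma)\notin V(\mathbb{C})$. In this statement a von Dyck group means a (hyperbolic) group of the displayed form. *)

theory Defs
  imports
    "HOL-Algebra.Solvable_Groups"
    "HOL-Analysis.Abstract_Topology"
    "Jordan_Normal_Form.Matrix"
begin

section \<open>Linear algebraic groups over the complex numbers\<close>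

definition GL :: "nat \<Rightarrow> complex mat monoid" where
  "GL n = units_of (ring_mat TYPE(complex) n ())"

lemma group_GL: "group (GL n)"
proof -
  interpret ring "ring_mat TYPE(complex) n ()" by (rule ring_mat)
  show ?thesis unfolding GL_def by (rule units_group)
qed

inductive_set mat_poly_fun :: "nat \<Rightarrow> (complex mat \<Rightarrow> complex) set" for n :: nat where
  const: "(\<lambda>A. c) \<in> mat_poly_fun n"
| entry: "i < n \<Longrightarrow> j < n \<Longrightarrow> (\<lambda>A. A $$ (i, j)) \<in> mat_poly_fun n"
| add: "f \<in> mat_poly_fun n \<Longrightarrow> g \<in> mat_poly_fun n \<Longrightarrow> (\<lambda>A. f A + g A) \<in> mat_poly_fun n"
| mult: "f \<in> mat_poly_fun n \<Longrightarrow> g \<in> mat_poly_fun n \<Longrightarrow> (\<lambda>A. f A * g A) \<in> mat_poly_fun n"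

text \<open>Regular functions on \<open>GL n\<close> may also involve the inverse of the determinant. As the
  determinant has no zeros there, clearing denominators shows that this gives no further
  zero loci.\<close>

definition zero_locus :: "nat \<Rightarrow> (complex mat \<Rightarrow> complex) set \<Rightarrow> complex mat set" where
  "zero_locus n S = {A \<in> carrier (GL n). \<forall>f\<in>S. f A = 0}"

definition zariski :: "nat \<Rightarrow> complex mat topology" where
  "zariski n = topology (\<lambda>U. \<exists>S \<subseteq> mat_poly_fun n. U = carrier (GL n) - zero_locus n S)"

lemma istopology_zariski:
  "istopology (\<lambda>U. \<exists>S \<subseteq> mat_poly_fun n. U = carrier (GL n) - zero_locus n S)"
  unfolding istopology_def
proof (intro conjI allI impI)
  fix U V
  assume "\<exists>S \<subseteq> mat_poly_fun n. U = carrier (GL n) - zero_locus n S"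
    and "\<exists>S \<subseteq> mat_poly_fun n. V = carrier (GL n) - zero_locus n S"
  then obtain S T where S: "S \<subseteq> mat_poly_fun n" "U = carrier (GL n) - zero_locus n S"
    and T: "T \<subseteq> mat_poly_fun n" "V = carrier (GL n) - zero_locus n T" by blast
  let ?P = "{\<lambda>A. f A * g A | f g. f \<in> S \<and> g \<in> T}"
  have "?P \<subseteq> mat_poly_fun n" using S(1) T(1) by (auto intro: mat_poly_fun.mult)
  moreover have "U \<inter> V = carrier (GL n) - zero_locus n ?P"
    unfolding S(2) T(2) zero_locus_def by fastforce
  ultimately show "\<exists>S \<subseteq> mat_poly_fun n. U \<inter> V = carrier (GL n) - zero_locus n S" by blast
next
  fix K
  assume K: "\<forall>U\<in>K. \<exists>S \<subseteq> mat_poly_fun n. U = carrier (GL n) - zero_locus n S"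
  then obtain s where s: "\<And>U. U \<in> K \<Longrightarrow> s U \<subseteq> mat_poly_fun n"
    "\<And>U. U \<in> K \<Longrightarrow> U = carrier (GL n) - zero_locus n (s U)" by metis
  have "\<Union>K = (\<Union>U\<in>K. carrier (GL n) - zero_locus n (s U))" using s(2) by auto
  also have "\<dots> = carrier (GL n) - zero_locus n (\<Union>U\<in>K. s U)"
    unfolding zero_locus_def by blast
  finally have "\<Union>K = carrier (GL n) - zero_locus n (\<Union>U\<in>K. s U)" .
  moreover have "(\<Union>U\<in>K. s U) \<subseteq> mat_poly_fun n" using s(1) by blast
  ultimately show "\<exists>S \<subseteq> mat_poly_fun n. \<Union>K = carrier (GL n) - zero_locus n S" by blast
qed

lemma openin_zariski:
  "openin (zariski n) U \<longleftrightarrow> (\<exists>S \<subseteq> mat_poly_fun n. U = carrier (GL n) - zero_locus n S)"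
  unfolding zariski_def by (simp add: topology_inverse'[OF istopology_zariski])

lemma topspace_zariski: "topspace (zariski n) = carrier (GL n)"
proof
  show "topspace (zariski n) \<subseteq> carrier (GL n)"
    unfolding topspace_def openin_zariski by blast
  have "openin (zariski n) (carrier (GL n))"
    unfolding openin_zariski
    by (rule exI[of _ "{\<lambda>A. 1}"]) (auto simp: zero_locus_def intro: mat_poly_fun.const)
  then show "carrier (GL n) \<subseteq> topspace (zariski n)" by (rule openin_subset)
qed

lemma closedin_zariski:
  "closedin (zariski n) V \<longleftrightarrow> (\<exists>S \<subseteq> mat_poly_fun n. V = zero_locus n S)"
proof -
  have "zero_locus n S \<subseteq> carrier (GL n)" for S by (auto simp: zero_locus_def)
  then show ?thesis
    unfolding closedin_def topspace_zariski openin_zariski by (metis double_diff subset_refl)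
qed

definition linear_algebraic_group :: "nat \<Rightarrow> complex mat set \<Rightarrow> bool" where
  "linear_algebraic_group n G \<longleftrightarrow> subgroup G (GL n) \<and> closedin (zariski n) G"

text \<open>The last clause says that the radical, i.e. the largest closed connected solvable normal
  subgroup, is trivial.\<close>

definition connected_semisimple :: "nat \<Rightarrow> complex mat set \<Rightarrow> bool" where
  "connected_semisimple n G \<longleftrightarrow>
     linear_algebraic_group n G \<and> connectedin (zariski n) G \<and>
     (\<forall>N. N \<lhd> (GL n\<lparr>carrier := G\<rparr>) \<and> closedin (zariski n) N \<and> connectedin (zariski n) N \<and>
          solvable (GL n\<lparr>carrier := N\<rparr>) \<longrightarrow> N = {\<one>\<^bsub>GL n\<^esub>})"

section \<open>Borel's property\<close>

definition borel_property :: "('a, 'b) monoid_scheme \<Rightarrow> bool" where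
  "borel_property \<Gamma> \<longleftrightarrow>
     (\<forall>n G V \<gamma>. connected_semisimple n G \<and> closedin (zariski n) V \<and> V \<subset> G \<and>
        \<gamma> \<in> carrier \<Gamma> \<and> \<gamma> \<noteq> \<one>\<^bsub>\<Gamma>\<^esub> \<and> (\<forall>k::nat. k > 0 \<longrightarrow> \<gamma> [^]\<^bsub>\<Gamma>\<^esub> k \<noteq> \<one>\<^bsub>\<Gamma>\<^esub>) \<longrightarrow>
        (\<exists>\<phi> \<in> hom \<Gamma> (GL n\<lparr>carrier := G\<rparr>). \<phi> \<gamma> \<notin> V))"

section \<open>Group presentations\<close>

text \<open>A letter \<open>(x, True)\<close> stands for the generator \<open>x\<close>, a letter \<open>(x, False)\<close> for its inverse.
  All elements of the type \<open>'x\<close> are generators.\<close>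

type_synonym 'x word = "('x \<times> bool) list"

inductive pres_eq :: "'x word set \<Rightarrow> 'x word \<Rightarrow> 'x word \<Rightarrow> bool" for R :: "'x word set" where
  refl: "pres_eq R u u"
| sym: "pres_eq R u v \<Longrightarrow> pres_eq R v u"
| trans: "pres_eq R u v \<Longrightarrow> pres_eq R v w \<Longrightarrow> pres_eq R u w"
| cancel: "pres_eq R (u @ [(x, e), (x, \<not> e)] @ v) (u @ v)"
| relator: "r \<in> R \<Longrightarrow> pres_eq R (u @ r @ v) (u @ v)"

definition pres_class :: "'x word set \<Rightarrow> 'x word \<Rightarrow> 'x word set" where
  "pres_class R u = {w. pres_eq R u w}"

definition presented_group :: "'x word set \<Rightarrow> 'x word set monoid" where
  "presented_group R =
     \<lparr>carrier = range (pres_class R),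
      monoid.mult = (\<lambda>C D. {w. \<exists>u\<in>C. \<exists>v\<in>D. pres_eq R (u @ v) w}),
      one = pres_class R []\<rparr>"

lemma pres_eq_append:
  assumes "pres_eq R u u'" "pres_eq R v v'"
  shows "pres_eq R (u @ v) (u' @ v')"
proof -
  have left: "pres_eq R (w @ s) (w @ t)" if "pres_eq R s t" for w s t
    using that
  proof induction
    case (cancel u x e v)
    show ?case using pres_eq.cancel[of R "w @ u" x e v] by simp
  next
    case (relator r u v)
    then show ?case using pres_eq.relator[of r R "w @ u" v] by simp
  qed (blast intro: pres_eq.intros)+
  have right: "pres_eq R (s @ w) (t @ w)" if "pres_eq R s t" for w s t
    using that
  proof induction
    case (cancel u x e v)
    show ?case using pres_eq.cancel[of R u x e "v @ w"] by simp
  next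
    case (relator r u v)
    then show ?case using pres_eq.relator[of r R u "v @ w"] by simp
  qed (blast intro: pres_eq.intros)+
  show ?thesis using left[OF assms(2)] right[OF assms(1)] pres_eq.trans by blast
qed

lemma pres_class_eq_iff: "pres_class R u = pres_class R v \<longleftrightarrow> pres_eq R u v"
  unfolding pres_class_def by (blast intro: pres_eq.refl pres_eq.sym pres_eq.trans)

lemma presented_group_mult:
  "pres_class R u \<otimes>\<^bsub>presented_group R\<^esub> pres_class R v = pres_class R (u @ v)"
  unfolding presented_group_def pres_class_def
  by (auto intro: pres_eq.refl pres_eq.trans pres_eq_append)

lemma pres_eq_inverse:
  "pres_eq R (rev (map (\<lambda>(x, e). (x, \<not> e)) w) @ w) []"
proof (induction w)
  case (Cons l w)
  obtain x e where l: "l = (x, e)" by force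
  let ?v = "rev (map (\<lambda>(x, e). (x, \<not> e)) w)"
  have "pres_eq R (?v @ [(x, \<not> e), (x, \<not> \<not> e)] @ w) (?v @ w)" by (rule pres_eq.cancel)
  then show ?case using Cons.IH by (auto simp: l intro: pres_eq.trans)
qed (simp add: pres_eq.refl)

lemma group_presented_group: "group (presented_group R)"
proof (rule groupI)
  have carrier: "carrier (presented_group R) = range (pres_class R)"
    and one: "\<one>\<^bsub>presented_group R\<^esub> = pres_class R []"
    by (simp_all add: presented_group_def)
  show "C \<otimes>\<^bsub>presented_group R\<^esub> D \<in> carrier (presented_group R)"
    if "C \<in> carrier (presented_group R)" "D \<in> carrier (presented_group R)" for C D
    using that by (auto simp: carrier presented_group_mult)
  show "\<one>\<^bsub>presented_group R\<^esub> \<in> carrier (presented_group R)" by (simp add: carrier one)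
  show "C \<otimes>\<^bsub>presented_group R\<^esub> D \<otimes>\<^bsub>presented_group R\<^esub> E =
      C \<otimes>\<^bsub>presented_group R\<^esub> (D \<otimes>\<^bsub>presented_group R\<^esub> E)"
    if "C \<in> carrier (presented_group R)" "D \<in> carrier (presented_group R)"
      "E \<in> carrier (presented_group R)" for C D E
    using that by (auto simp: carrier presented_group_mult)
  show "\<one>\<^bsub>presented_group R\<^esub> \<otimes>\<^bsub>presented_group R\<^esub> C = C"
    if "C \<in> carrier (presented_group R)" for C
    using that by (auto simp: carrier one presented_group_mult)
  show "\<exists>D\<in>carrier (presented_group R). D \<otimes>\<^bsub>presented_group R\<^esub> C = \<one>\<^bsub>presented_group R\<^esub>"
    if "C \<in> carrier (presented_group R)" for C
    using that pres_eq_inverse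
    by (force simp: carrier one presented_group_mult pres_class_eq_iff)
qed

section \<open>Von Dyck groups\<close>

datatype dyck_gen = X1 | X2 | X3

definition von_dyck_group :: "nat \<Rightarrow> nat \<Rightarrow> nat \<Rightarrow> dyck_gen word set monoid" where
  "von_dyck_group a b c = presented_group
     {replicate a (X1, True), replicate b (X2, True), replicate c (X3, True),
      [(X1, True), (X2, True), (X3, True)]}"

end

(* Take G = SL_2 and let gamma be the commutator of x_1 and x_2. By Fricke's identity the trace of
   phi(gamma) is x^2 + y^2 + z^2 - x y z - 2, where x, y, z are the traces of phi(x_1), phi(x_2),
   phi(x_3). Elements of SL_2 of order dividing n have only finitely many traces, so phi(gamma)
   always lies in the proper closed subset of SL_2 on which the trace takes one of finitely many
   values. The element gamma has infinite order because the hyperbolic triangle group acts through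
   matrices of traces 2 cos(pi/a), 2 cos(pi/b), -2 cos(pi/c), which satisfy the relations up to
   sign; the commutator then has trace greater than 2. *)

theory Submission
  imports Defs "HOL-Analysis.Convex"
begin

section \<open>Two-by-two matrices\<close>

definition mat2 :: "'a \<Rightarrow> 'a \<Rightarrow> 'a \<Rightarrow> 'a \<Rightarrow> 'a mat" where
  "mat2 p q r s = mat 2 2 (\<lambda>(i, j). if i = 0 then (if j = 0 then p else q)
                                     else (if j = 0 then r else s))"

lemma mat2_dim [simp]: "mat2 p q r s \<in> carrier_mat 2 2"
  "dim_row (mat2 p q r s) = 2" "dim_col (mat2 p q r s) = 2"
  by (auto simp: mat2_def)

lemma mat2_index [simp]:
  "mat2 p q r s $$ (0, 0) = p" "mat2 p q r s $$ (0, Suc 0) = q"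
  "mat2 p q r s $$ (Suc 0, 0) = r" "mat2 p q r s $$ (Suc 0, Suc 0) = s"
  by (auto simp: mat2_def)

lemma mat2_eq_iff [simp]:
  "mat2 p q r s = mat2 p' q' r' s' \<longleftrightarrow> p = p' \<and> q = q' \<and> r = r' \<and> s = s'"
  by (metis mat2_index)

lemma mat2_cases:
  assumes "A \<in> carrier_mat 2 2"
  obtains p q r s where "A = mat2 p q r s"
proof
  show "A = mat2 (A $$ (0, 0)) (A $$ (0, Suc 0)) (A $$ (Suc 0, 0)) (A $$ (Suc 0, Suc 0))"
    using assms by (intro eq_matI) (auto simp: mat2_def less_2_cases_iff)
qed

lemma mat2_mult [simp]:
  fixes p :: "'a :: comm_ring_1"
  shows "mat2 p q r s * mat2 p' q' r' s' =
    mat2 (p * p' + q * r') (p * q' + q * s') (r * p' + s * r') (r * q' + s * s')"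
  by (intro eq_matI) (auto simp: less_2_cases_iff scalar_prod_def, simp_all add: numeral_2_eq_2)

lemma one_mat_2: "1\<^sub>m 2 = mat2 1 0 0 1"
  by (intro eq_matI) (auto simp: less_2_cases_iff)

lemma smult_mat2 [simp]: "c \<cdot>\<^sub>m mat2 p q r s = mat2 (c * p) (c * q) (c * r) (c * s)"
  by (intro eq_matI) (auto simp: less_2_cases_iff)

section \<open>Traces, eigenvalues and powers of matrices of determinant 1\<close>

definition tr2 :: "complex mat \<Rightarrow> complex" where
  "tr2 A = A $$ (0, 0) + A $$ (1, 1)"

lemma tr2_mat2 [simp]: "tr2 (mat2 p q r s) = p + s"
  by (simp add: tr2_def)

text \<open>The roots of X^2 - t X + 1, the characteristic polynomial of a matrix of determinant 1
  and trace \<open>t\<close>, are nonzero and mutually inverse; the quadratic formula supplies one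
  over the complex numbers.\<close>

lemma ex_eigenvalue: "\<exists>l::complex. l \<noteq> 0 \<and> t = l + 1 / l"
proof -
  define d where "d = csqrt (t\<^sup>2 - 4)"
  define l where "l = (t + d) / 2"
  have "d\<^sup>2 = t\<^sup>2 - 4" by (simp add: d_def)
  then have *: "l * (t - l) = 1"
    by (simp add: l_def field_simps power2_eq_square)
  then have nz: "l \<noteq> 0" by auto
  with * have "t - l = 1 / l" by (metis nonzero_mult_div_cancel_left)
  then have "t = l + 1 / l" by (simp add: algebra_simps)
  with nz show ?thesis by blast
qed

text \<open>The coefficients \<open>x\<close> and \<open>y\<close> are pinned down by evaluating the power at the two
  eigenvalues \<open>l\<close> and \<open>1 / l\<close>.\<close>

lemma mat2_pow:
  fixes l :: complex
  assumes "p * s - q * r = 1" "p + s = l + 1 / l" "l \<noteq> 0"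
  shows "\<exists>x y. mat2 p q r s ^\<^sub>m n = mat2 (x + y * p) (y * q) (y * r) (x + y * s) \<and>
               x + y * l = l ^ n \<and> x + y / l = 1 / l ^ n"
proof (induction n)
  case 0
  show ?case by (intro exI[of _ 1] exI[of _ 0]) (simp add: one_mat_2)
next
  case (Suc n)
  then obtain x y where xy: "mat2 p q r s ^\<^sub>m n = mat2 (x + y * p) (y * q) (y * r) (x + y * s)"
    "x + y * l = l ^ n" "x + y / l = 1 / l ^ n" by blast
  have det: "y * (p * s) = y + y * (q * r)"
    using arg_cong[OF assms(1), of "(*) y"] by (simp add: algebra_simps)
  show ?case
  proof (intro exI conjI)
    \<comment> \<open>By Cayley-Hamilton M^2 = (p + s) M - 1, so (x + y M) M = -y + (x + y (p + s))
      M; these are the new coefficients.\<close>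
    show "mat2 p q r s ^\<^sub>m Suc n =
      mat2 (- y + (x + y * (p + s)) * p) ((x + y * (p + s)) * q)
           ((x + y * (p + s)) * r) (- y + (x + y * (p + s)) * s)"
      using det by (simp add: xy(1) algebra_simps)
    show "- y + (x + y * (p + s)) * l = l ^ Suc n"
      using assms(3) by (simp add: assms(2) xy(2)[symmetric] field_simps)
    show "- y + (x + y * (p + s)) / l = 1 / l ^ Suc n"
    proof -
      have "- y + (x + y * (p + s)) / l = (x + y / l) / l"
        using assms(3) by (simp add: assms(2) field_simps)
      then show ?thesis by (simp add: xy(3))
    qed
  qed
qed

lemma tr2_pow:
  fixes l :: complex
  assumes "p * s - q * r = 1" "p + s = l + 1 / l" "l \<noteq> 0"
  shows "tr2 (mat2 p q r s ^\<^sub>m n) = l ^ n + 1 / l ^ n"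
proof -
  obtain x y where xy: "mat2 p q r s ^\<^sub>m n = mat2 (x + y * p) (y * q) (y * r) (x + y * s)"
    "x + y * l = l ^ n" "x + y / l = 1 / l ^ n" using mat2_pow[OF assms] by blast
  have "tr2 (mat2 p q r s ^\<^sub>m n) = (x + y * l) + (x + y / l)"
    using arg_cong[OF assms(2), of "(*) y"] by (simp add: xy(1) algebra_simps)
  then show ?thesis by (simp add: xy)
qed

text \<open>Since \<open>e\<close> is its own inverse, the polynomial x + y X that represents the
  power takes the value \<open>e\<close> at both \<open>l\<close> and \<open>1 / l\<close>. These
  are distinct because \<open>l\<^sup>2 \<noteq> 1\<close>, so the polynomial is constant. For
  \<open>l\<^sup>2 = 1\<close> a nontrivial unipotent would be a counterexample.\<close>

lemma mat2_pow_scalar: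
  fixes l :: complex
  assumes "p * s - q * r = 1" "p + s = l + 1 / l" "l\<^sup>2 \<noteq> 1" "l \<noteq> 0"
    "l ^ n = e" "e\<^sup>2 = 1"
  shows "mat2 p q r s ^\<^sub>m n = e \<cdot>\<^sub>m 1\<^sub>m 2"
proof -
  obtain x y where xy: "mat2 p q r s ^\<^sub>m n = mat2 (x + y * p) (y * q) (y * r) (x + y * s)"
    "x + y * l = l ^ n" "x + y / l = 1 / l ^ n" using mat2_pow[OF assms(1,2,4)] by blast
  have "e \<noteq> 0" using assms(6) by auto
  then have "1 / e = e" using assms(6) by (simp add: field_simps power2_eq_square)
  then have "y * l = y / l" using xy assms(5) by (metis add_left_cancel)
  then have "y * (l\<^sup>2 - 1) = 0" using assms(4) by (simp add: field_simps power2_eq_square)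
  then have "y = 0" using assms(3) by simp
  then show ?thesis using xy assms(5) by (simp add: one_mat_2)
qed

section \<open>The special linear group\<close>

definition SL2 :: "complex mat set" where
  "SL2 = {mat2 p q r s | p q r s. p * s - q * r = 1}"

lemma mat2_in_SL2 [simp]: "mat2 p q r s \<in> SL2 \<longleftrightarrow> p * s - q * r = 1"
  by (auto simp: SL2_def)

lemma SL2_cases:
  assumes "A \<in> SL2"
  obtains p q r s where "A = mat2 p q r s" "p * s - q * r = 1"
  using assms by (auto simp: SL2_def)

lemma GL_mult [simp]: "A \<otimes>\<^bsub>GL n\<^esub> B = A * B"
  by (simp add: GL_def units_of_mult ring_mat_simps)

lemma GL_one [simp]: "\<one>\<^bsub>GL n\<^esub> = 1\<^sub>m n"
  by (simp add: GL_def units_of_one ring_mat_simps)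

lemma carrier_GL_subset: "carrier (GL n) \<subseteq> carrier_mat n n"
  by (auto simp: GL_def units_of_carrier Units_def ring_mat_simps)

lemma mat2_inverse:
  assumes "p * s - q * r = (1 :: complex)"
  shows "mat2 s (- q) (- r) p * mat2 p q r s = 1\<^sub>m 2"
    "mat2 p q r s * mat2 s (- q) (- r) p = 1\<^sub>m 2"
  using assms by (auto simp: one_mat_2 algebra_simps)

lemma SL2_subset_GL: "SL2 \<subseteq> carrier (GL 2)"
proof
  fix A assume "A \<in> SL2"
  then obtain p q r s where A: "A = mat2 p q r s" "p * s - q * r = 1" by (rule SL2_cases)
  then show "A \<in> carrier (GL 2)"
    using mat2_inverse[OF A(2)]
    by (auto simp: GL_def units_of_carrier Units_def ring_mat_simps
        intro!: bexI[of _ "mat2 s (- q) (- r) p"])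
qed

lemma SL2_mult:
  assumes "A \<in> SL2" "B \<in> SL2"
  shows "A * B \<in> SL2"
proof -
  obtain p q r s where A: "A = mat2 p q r s" "p * s - q * r = 1" using assms(1) by (rule SL2_cases)
  obtain p' q' r' s' where B: "B = mat2 p' q' r' s'" "p' * s' - q' * r' = 1"
    using assms(2) by (rule SL2_cases)
  have "(p * p' + q * r') * (r * q' + s * s') - (p * q' + q * s') * (r * p' + s * r') =
    (p * s - q * r) * (p' * s' - q' * r')" by (simp add: algebra_simps)
  then show ?thesis using A B by simp
qed

lemma GL_inv_mat2:
  assumes "p * s - q * r = 1"
  shows "inv\<^bsub>GL 2\<^esub> (mat2 p q r s) = mat2 s (- q) (- r) p"
proof -
  have "mat2 p q r s \<in> carrier (GL 2)" "mat2 s (- q) (- r) p \<in> carrier (GL 2)"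
    using assms SL2_subset_GL by (auto simp: subset_iff algebra_simps)
  then show ?thesis
    using mat2_inverse(1)[OF assms] by (intro group.inv_equality[OF group_GL]) auto
qed

lemma subgroup_SL2: "subgroup SL2 (GL 2)"
proof (rule group.subgroupI[OF group_GL])
  have "mat2 1 0 0 1 \<in> SL2" by simp
  then show "SL2 \<noteq> {}" by blast
  show "inv\<^bsub>GL 2\<^esub> A \<in> SL2" if "A \<in> SL2" for A
    using that by (elim SL2_cases) (simp add: GL_inv_mat2 algebra_simps)
qed (auto simp: SL2_subset_GL SL2_mult)

abbreviation SL2_group :: "complex mat monoid" where
  "SL2_group \<equiv> GL 2\<lparr>carrier := SL2\<rparr>"

lemma group_SL2: "group SL2_group"
  by (rule subgroup.subgroup_is_group[OF subgroup_SL2 group_GL])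

lemma SL2_inv_mat2:
  assumes "p * s - q * r = 1"
  shows "inv\<^bsub>SL2_group\<^esub> (mat2 p q r s) = mat2 s (- q) (- r) p"
  using assms mat2_inverse(1)[OF assms]
  by (intro group.inv_equality[OF group_SL2]) (auto simp: algebra_simps)

section \<open>Zariski-closed subsets of SL2\<close>

lemma mat_poly_fun_diff:
  assumes "f \<in> mat_poly_fun n" "g \<in> mat_poly_fun n"
  shows "(\<lambda>A. f A - g A) \<in> mat_poly_fun n"
  using mat_poly_fun.add[OF assms(1) mat_poly_fun.mult[OF mat_poly_fun.const[of "-1"] assms(2)]]
  by simp

lemma mat_poly_fun_prod:
  assumes "finite T" "\<And>t. t \<in> T \<Longrightarrow> f t \<in> mat_poly_fun n"
  shows "(\<lambda>A. \<Prod>t\<in>T. f t A) \<in> mat_poly_fun n"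
  using assms by (induction T rule: finite_induct) (auto intro: mat_poly_fun.intros)

lemma mat_poly_fun_tr2: "tr2 \<in> mat_poly_fun 2"
  unfolding tr2_def by (intro mat_poly_fun.intros) auto

lemma closedin_zero_locus: "S \<subseteq> mat_poly_fun n \<Longrightarrow> closedin (zariski n) (zero_locus n S)"
  by (auto simp: closedin_zariski)

definition det2 :: "complex mat \<Rightarrow> complex" where
  "det2 A = A $$ (0, 0) * A $$ (1, 1) - A $$ (0, 1) * A $$ (1, 0)"

lemma mat_poly_fun_det2: "det2 \<in> mat_poly_fun 2"
  unfolding det2_def by (intro mat_poly_fun_diff mat_poly_fun.intros) auto

lemma SL2_iff: "A \<in> SL2 \<longleftrightarrow> A \<in> carrier (GL 2) \<and> det2 A = 1"
proof
  assume "A \<in> SL2"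
  then show "A \<in> carrier (GL 2) \<and> det2 A = 1"
    using SL2_subset_GL by (elim SL2_cases) (auto simp: det2_def)
next
  assume *: "A \<in> carrier (GL 2) \<and> det2 A = 1"
  then have "A \<in> carrier_mat 2 2" using carrier_GL_subset by blast
  then obtain p q r s where A: "A = mat2 p q r s" by (rule mat2_cases)
  then show "A \<in> SL2" using * by (simp add: det2_def)
qed

text \<open>Finitely many trace values are cut out by one product of linear factors in the trace.
  This serves twice: to separate the identity from its negative, and to produce the subvariety that
  violates Borel's property.\<close>

lemma closedin_SL2_trace:
  assumes "finite T"
  shows "closedin (zariski 2) {A \<in> SL2. tr2 A \<in> T}"
proof -
  let ?S = "{\<lambda>A. det2 A - 1, \<lambda>A. \<Prod>t\<in>T. (tr2 A - t)}"
  have "{A \<in> SL2. tr2 A \<in> T} = zero_locus 2 ?S"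
    using assms by (auto simp: zero_locus_def SL2_iff)
  moreover have "?S \<subseteq> mat_poly_fun 2"
    using assms by (auto intro!: mat_poly_fun_diff mat_poly_fun_prod mat_poly_fun.const
        mat_poly_fun_tr2 mat_poly_fun_det2)
  ultimately show ?thesis by (metis closedin_zero_locus)
qed

lemma closedin_SL2: "closedin (zariski 2) SL2"
proof -
  have "SL2 = zero_locus 2 {\<lambda>A. det2 A - 1}" by (auto simp: zero_locus_def SL2_iff)
  moreover have "{\<lambda>A. det2 A - 1} \<subseteq> mat_poly_fun 2"
    by (auto intro!: mat_poly_fun_diff mat_poly_fun.const mat_poly_fun_det2)
  ultimately show ?thesis by (metis closedin_zero_locus)
qed

lemma linear_algebraic_group_SL2: "linear_algebraic_group 2 SL2"
  by (simp add: linear_algebraic_group_def subgroup_SL2 closedin_SL2)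

section \<open>Unipotent factorisation and Zariski connectedness\<close>

text \<open>A fixed number of unipotent factors gives both a polynomial parametrisation of SL2 by
  C^4, used for connectedness, and generation by unipotents, used for normal subgroups.\<close>

lemma SL2_elementary:
  assumes "A \<in> SL2"
  shows "\<exists>x y z w. A = mat2 1 0 x 1 * mat2 1 y 0 1 * mat2 1 0 z 1 * mat2 1 w 0 1"
proof -
  obtain p q r s where A: "A = mat2 p q r s" "p * s - q * r = 1" using assms by (rule SL2_cases)
  have nz: "\<exists>y z w. mat2 p q r s = mat2 1 y 0 1 * mat2 1 0 z 1 * mat2 1 w 0 1"
    if "r \<noteq> 0" "p * s - q * r = 1" for p q r s :: complex
    using that
    \<comment> \<open>The product has lower-left entry z and diagonal entries 1 + y z and 1 + z w,
      which dictates the three witnesses; the last entry then agrees because the determinant is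
      1.\<close>
    by (intro exI[of _ "(p - 1) / r"] exI[of _ r] exI[of _ "(s - 1) / r"]) (simp add: field_simps)
  show ?thesis
  proof (cases "r = 0")
    case False
    then obtain y z w where "A = mat2 1 y 0 1 * mat2 1 0 z 1 * mat2 1 w 0 1"
      using nz A by blast
    then show ?thesis by (intro exI[of _ 0] exI[of _ y] exI[of _ z] exI[of _ w]) simp
  next
    case True
    then have "p \<noteq> 0" using A(2) by auto
    \<comment> \<open>Adding the first row to the second puts the nonzero \<open>p\<close> in the
      lower-left corner, which reduces to the previous case; the extra lower unipotent factor undoes
      this.\<close>
    then obtain y z w where *: "mat2 p q p (q + s) = mat2 1 y 0 1 * mat2 1 0 z 1 * mat2 1 w 0 1"
      using nz[of p p "q + s" q] A(2) True by (metis add.commute add_diff_cancel_left' diff_zero distrib_left mult.commute mult_zero_right)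
    have "A = mat2 1 0 (- 1) 1 * mat2 p q p (q + s)" using True A(1) by simp
    then show ?thesis unfolding *
      by (intro exI[of _ "-1"] exI[of _ y] exI[of _ z] exI[of _ w]) (simp add: algebra_simps)
  qed
qed

text \<open>The parametrisation \<open>P\<close> is continuous from the Euclidean to the Zariski
  topology, since polynomials in its entries are continuous. So SL2 is the image of the convex,
  hence connected, space C^4.\<close>

lemma connectedin_SL2: "connectedin (zariski 2) SL2"
proof -
  define P :: "complex \<times> complex \<times> complex \<times> complex \<Rightarrow> complex mat" where
    "P = (\<lambda>(x, y, z, w). mat2 1 0 x 1 * mat2 1 y 0 1 * mat2 1 0 z 1 * mat2 1 w 0 1)"
  have SL2: "P v \<in> SL2" for v
    by (cases v) (simp add: P_def del: mat2_mult, intro SL2_mult, auto)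
  have range: "range P = SL2"
  proof
    show "SL2 \<subseteq> range P"
    proof
      fix A assume "A \<in> SL2"
      then obtain x y z w where "A = P (x, y, z, w)"
        using SL2_elementary unfolding P_def by force
      then show "A \<in> range P" by blast
    qed
  qed (use SL2 in blast)
  have cont: "continuous_on UNIV (\<lambda>v. f (P v))" if "f \<in> mat_poly_fun 2" for f
    using that
  proof induction
    case (entry i j)
    then show ?case
      by (auto simp: less_2_cases_iff P_def case_prod_unfold intro!: continuous_intros)
  qed (auto intro: continuous_intros)
  have "continuous_map euclidean (zariski 2) P"
    unfolding continuous_map_closedin
  proof (intro conjI allI impI Pi_I)
    show "P v \<in> topspace (zariski 2)" for v
      using subsetD[OF SL2_subset_GL SL2] by (simp add: topspace_zariski)
    fix C assume "closedin (zariski 2) C"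
    then obtain S where S: "S \<subseteq> mat_poly_fun 2" "C = zero_locus 2 S"
      by (auto simp: closedin_zariski)
    have "{v. P v \<in> C} = (\<Inter>f\<in>S. {v. f (P v) = 0})"
      using SL2 SL2_subset_GL by (auto simp: S(2) zero_locus_def)
    moreover have "closed (\<Inter>f\<in>S. {v. f (P v) = 0})"
      using cont S(1) by (intro closed_INT ballI closed_Collect_eq) auto
    ultimately show "closedin euclidean {v \<in> topspace euclidean. P v \<in> C}" by simp
  qed
  moreover have "connectedin euclidean (UNIV :: (complex \<times> complex \<times> complex \<times> complex) set)"
    by (simp add: convex_connected)
  ultimately show ?thesis using connectedin_continuous_map_image range by metis
qed


section \<open>Normal subgroups, perfectness and semisimplicity of SL2\<close>

text \<open>Conjugates and commutators of a single non-scalar element already yield all lower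
  unipotents, then all upper ones, and together these generate SL2.\<close>

lemma normal_SL2_eq:
  assumes N: "N \<lhd> SL2_group" and g: "mat2 p q r s \<in> N" and nc: "\<not> (q = 0 \<and> r = 0 \<and> p = s)"
  shows "N = SL2"
proof -
  have sub: "subgroup N SL2_group" by (rule group.normal_invE(1)[OF group_SL2 N])
  have N_SL2: "N \<subseteq> SL2" using subgroup.subset[OF sub] by simp
  have conj: "mat2 p q r s * h * mat2 s (- q) (- r) p \<in> N"
    if "h \<in> N" "p * s - q * r = 1" for p q r s h
    using group.normal_invE(2)[OF group_SL2 N, of "mat2 p q r s" h] that by (simp add: SL2_inv_mat2)
  have mult: "h * k \<in> N" if "h \<in> N" "k \<in> N" for h k
    using subgroup.m_closed[OF sub that] by simp
  have inverse: "mat2 s (- q) (- r) p \<in> N" if "mat2 p q r s \<in> N" for p q r s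
    using subgroup.m_inv_closed[OF sub that] that N_SL2 by (auto simp: SL2_inv_mat2)
  have "\<exists>p q r s. mat2 p q r s \<in> N \<and> r \<noteq> 0"
  proof (cases "r = 0")
    case r: True
    show ?thesis
    proof (cases "q = 0")
      case True
      \<comment> \<open>For a diagonal matrix, conjugation by a lower unipotent creates the entry
        \<open>p - s\<close>, nonzero because the matrix is not scalar.\<close>
      have "mat2 1 0 1 1 * mat2 p q r s * mat2 1 (- 0) (- 1) 1 \<in> N" by (rule conj[OF g]) simp
      then have "mat2 p 0 (p - s) s \<in> N" using r True by simp
      moreover have "p - s \<noteq> 0" using r True nc by simp
      ultimately show ?thesis by blast
    next
      case False
      have "mat2 0 (- 1) 1 0 * mat2 p q r s * mat2 0 (- (- 1)) (- 1) 0 \<in> N" by (rule conj[OF g]) simp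
      then have "mat2 s 0 (- q) p \<in> N" using r by simp
      moreover have "- q \<noteq> 0" using False by simp
      ultimately show ?thesis by blast
    qed
  qed (use g in blast)
  then obtain p q r s where g1: "mat2 p q r s \<in> N" and r: "r \<noteq> 0" by blast
  then have det: "p * s - q * r = 1" using N_SL2 by auto
  define t where "t = p + s"
  \<comment> \<open>Conjugation by this upper unipotent clears the upper-left entry and keeps
    \<open>r\<close> and the trace; the determinant fixes the remaining entry.\<close>
  have "mat2 1 (- p / r) 0 1 * mat2 p q r s * mat2 1 (- (- p / r)) (- 0) 1 \<in> N"
    by (rule conj[OF g1]) simp
  also have "mat2 1 (- p / r) 0 1 * mat2 p q r s * mat2 1 (- (- p / r)) (- 0) 1 =
    mat2 0 (- (1 / r)) r t"
    using r det by (simp add: t_def field_simps)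
  finally have g2: "mat2 0 (- (1 / r)) r t \<in> N" .
  \<comment> \<open>The commutator of diag(2, 1/2) with the previous element is lower triangular
    with distinct eigenvalues 4 and 1/4.\<close>
  have "mat2 2 0 0 (1 / 2) * mat2 0 (- (1 / r)) r t * mat2 (1 / 2) (- 0) (- 0) 2 *
    mat2 t (- (- (1 / r))) (- r) 0 \<in> N"
    by (rule mult[OF conj[OF g2] inverse[OF g2]]) simp
  then obtain c where h: "mat2 4 0 c (1 / 4) \<in> N"
    using r by auto
  have lower: "mat2 1 0 x 1 \<in> N" for x
  proof -
    \<comment> \<open>Conjugation by \<open>mat2 4 0 c (1 / 4)\<close> divides the parameter of a
      lower unipotent by 16, so the commutator has parameter 15/16 of the original; the factor 16/15
      compensates.\<close>
    have "mat2 1 0 (16 * x / 15) 1 * mat2 4 0 c (1 / 4) * mat2 1 (- 0) (- (16 * x / 15)) 1 *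
      mat2 (1 / 4) (- 0) (- c) 4 \<in> N"
      by (rule mult[OF conj[OF h] inverse[OF h]]) simp
    then show ?thesis by (simp add: field_simps)
  qed
  have upper: "mat2 1 y 0 1 \<in> N" for y
  proof -
    \<comment> \<open>The Weyl element exchanges lower and upper unipotents and changes the sign of
      the parameter.\<close>
    have "mat2 0 (- 1) 1 0 * mat2 1 0 (- y) 1 * mat2 0 (- (- 1)) (- 1) 0 \<in> N"
      by (rule conj[OF lower]) simp
    then show ?thesis by simp
  qed
  have "SL2 \<subseteq> N"
  proof
    fix A assume "A \<in> SL2"
    then obtain x y z w
      where "A = mat2 1 0 x 1 * mat2 1 y 0 1 * mat2 1 0 z 1 * mat2 1 w 0 1"
      using SL2_elementary by blast
    then show "A \<in> N" using mult lower upper by metis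
  qed
  with N_SL2 show ?thesis by blast
qed

text \<open>The derived subgroup is normal and contains a nontrivial unipotent, namely the
  commutator of diag(2, 1/2) with a lower unipotent, so \<open>normal_SL2_eq\<close>
  applies.\<close>

lemma derived_SL2: "derived SL2_group SL2 = SL2"
proof -
  let ?d = "mat2 2 0 0 (1 / 2) :: complex mat" and ?u = "mat2 1 0 1 1 :: complex mat"
  have "?d * ?u * mat2 (1 / 2) (- 0) (- 0) 2 * mat2 1 (- 0) (- 1) 1 \<in> derived_set SL2_group SL2"
    by (intro UN_I[of ?d] UN_I[of ?u]) (simp_all add: SL2_inv_mat2)
  then have "mat2 1 0 (- 3 / 4) 1 \<in> derived SL2_group SL2"
    unfolding derived_def by (intro generate.incl) simp
  then show ?thesis
    using group.derived_self_is_normal[OF group_SL2] by (intro normal_SL2_eq) auto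
qed

lemma not_solvable_SL2: "\<not> solvable SL2_group"
proof
  assume "solvable SL2_group"
  then obtain n where "(derived SL2_group ^^ n) SL2 = {1\<^sub>m 2}"
    by (auto simp: group.solvable_iff_trivial_derived_seq[OF group_SL2])
  moreover have "(derived SL2_group ^^ n) SL2 = SL2" by (induction n) (simp_all add: derived_SL2)
  moreover have "mat2 1 0 1 1 \<in> SL2" by simp
  ultimately show False by (metis mat2_eq_iff one_mat_2 singletonD zero_neq_one)
qed

text \<open>A solvable normal subgroup is proper, hence consists of scalars of determinant 1, that
  is of plus or minus the identity. Connectedness then excludes the negative of the
  identity.\<close>

lemma connected_semisimple_SL2: "connected_semisimple 2 SL2"
  unfolding connected_semisimple_def
proof (intro conjI allI impI)
  fix N
  assume "N \<lhd> SL2_group \<and> closedin (zariski 2) N \<and> connectedin (zariski 2) N \<and>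
    solvable (GL 2\<lparr>carrier := N\<rparr>)"
  then have N: "N \<lhd> SL2_group" and con: "connectedin (zariski 2) N"
    and sol: "solvable (GL 2\<lparr>carrier := N\<rparr>)" by auto
  have sub: "subgroup N SL2_group" by (rule group.normal_invE(1)[OF group_SL2 N])
  have N_SL2: "N \<subseteq> SL2" using subgroup.subset[OF sub] by simp
  have one: "1\<^sub>m 2 \<in> N" using subgroup.one_closed[OF sub] by simp
  have "N \<noteq> SL2" using sol not_solvable_SL2 by auto
  have central: "A = mat2 1 0 0 1 \<or> A = mat2 (- 1) 0 0 (- 1)" if A: "A \<in> N" for A
  proof -
    obtain p q r s where *: "A = mat2 p q r s" "p * s - q * r = 1"
      using A N_SL2 by (meson SL2_cases subsetD)
    then have "q = 0 \<and> r = 0 \<and> p = s" using normal_SL2_eq[OF N] A \<open>N \<noteq> SL2\<close> by blast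
    moreover from this have "p\<^sup>2 = 1" using * by (simp add: power2_eq_square)
    ultimately show ?thesis using * by (auto simp: power2_eq_1_iff)
  qed
  have "mat2 (- 1) 0 0 (- 1) \<notin> N"
  proof
    assume neg: "mat2 (- 1) 0 0 (- 1) \<in> N"
    \<comment> \<open>The traces 2 and -2 would split \<open>N\<close> into two disjoint nonempty
      relatively closed pieces.\<close>
    let ?E = "\<lambda>t. {A \<in> SL2. tr2 A \<in> {t}}"
    have "closedin (zariski 2) (?E 2)" "closedin (zariski 2) (?E (- 2))"
      by (intro closedin_SL2_trace; simp)+
    moreover have "N \<subseteq> ?E 2 \<union> ?E (- 2)" using central by force
    moreover have "?E 2 \<inter> ?E (- 2) \<inter> N = {}" by auto
    moreover have "?E 2 \<inter> N \<noteq> {}" using one by (force simp: one_mat_2)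
    moreover have "?E (- 2) \<inter> N \<noteq> {}" using neg by force
    ultimately show False using con unfolding connectedin_closedin by blast
  qed
  then show "N = {\<one>\<^bsub>GL 2\<^esub>}" using central one by (auto simp: one_mat_2)
qed (rule linear_algebraic_group_SL2 connectedin_SL2)+

section \<open>Traces of commutators\<close>

lemma SL2_right_inverse:
  fixes p q r s :: complex
  assumes "p * s - q * r = 1" "C \<in> carrier_mat 2 2" "mat2 p q r s * C = 1\<^sub>m 2"
  shows "C = mat2 s (- q) (- r) p"
proof -
  have "C = mat2 s (- q) (- r) p * mat2 p q r s * C"
    using assms(2) by (simp only: mat2_inverse(1)[OF assms(1)] left_mult_one_mat)
  also have "\<dots> = mat2 s (- q) (- r) p * (mat2 p q r s * C)"
    by (rule assoc_mult_mat[OF _ _ assms(2)]) auto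
  finally show ?thesis using assms(3) by (simp add: one_mat_2)
qed

text \<open>Inversion merely swaps the diagonal entries. Through the relation x_1 x_2 x_3 = 1 this
  turns the trace of the image of x_1 x_2 into that of x_3.\<close>

lemma SL2_right_inverse_trace:
  assumes "A \<in> SL2" "C \<in> SL2" "A * C = 1\<^sub>m 2"
  shows "tr2 C = tr2 A"
proof -
  obtain p q r s where A: "A = mat2 p q r s" "p * s - q * r = 1" using assms(1) by (rule SL2_cases)
  then have "C = mat2 s (- q) (- r) p"
    using assms SL2_subset_GL carrier_GL_subset by (intro SL2_right_inverse) auto
  then show ?thesis using A by (simp add: add.commute)
qed

text \<open>Fricke's identity.\<close>

lemma tr2_commutator:
  assumes "A \<in> SL2" "B \<in> SL2" "A' \<in> SL2" "B' \<in> SL2" "A * A' = 1\<^sub>m 2" "B * B' = 1\<^sub>m 2"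
  shows "tr2 (A * B * A' * B') =
    (tr2 A)\<^sup>2 + (tr2 B)\<^sup>2 + (tr2 (A * B))\<^sup>2 - tr2 A * tr2 B * tr2 (A * B) - 2"
proof -
  obtain p q r s where A: "A = mat2 p q r s" "p * s - q * r = 1" using assms(1) by (rule SL2_cases)
  obtain t u v w where B: "B = mat2 t u v w" "t * w - u * v = 1" using assms(2) by (rule SL2_cases)
  have carrier: "SL2 \<subseteq> carrier_mat 2 2" using SL2_subset_GL carrier_GL_subset by blast
  have A': "A' = mat2 s (- q) (- r) p" using A assms carrier by (intro SL2_right_inverse) auto
  have B': "B' = mat2 w (- u) (- v) t" using B assms carrier by (intro SL2_right_inverse) auto
  \<comment> \<open>Inserting the determinants as factors makes the identity homogeneous, so that it
    holds for all values of the entries by mere expansion.\<close>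
  have "tr2 (A * B * A' * B') = (p + s)\<^sup>2 * (t * w - u * v) + (t + w)\<^sup>2 * (p * s - q * r) +
    (tr2 (A * B))\<^sup>2 - (p + s) * (t + w) * tr2 (A * B) - 2 * (p * s - q * r) * (t * w - u * v)"
    by (simp add: A(1) B(1) A' B' algebra_simps power2_eq_square)
  then show ?thesis using A B by simp
qed

section \<open>Traces of elements with a power equal to plus or minus the identity\<close>

text \<open>An eigenvalue \<open>l\<close> satisfies l^n + 1 / l^n = 2, hence (l^n - 1)^2 = 0, so
  \<open>l\<close> is one of the finitely many n-th roots of unity and determines the trace.\<close>

lemma finite_torsion_traces:
  assumes "n > 0"
  shows "finite {tr2 A | A. A \<in> SL2 \<and> A ^\<^sub>m n = 1\<^sub>m 2}"
proof (rule finite_subset)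
  show "finite ((\<lambda>l::complex. l + 1 / l) ` {l. l ^ n = 1})"
    using assms by (intro finite_imageI finite_roots_unity) simp
  show "{tr2 A | A. A \<in> SL2 \<and> A ^\<^sub>m n = 1\<^sub>m 2} \<subseteq> (\<lambda>l. l + 1 / l) ` {l. l ^ n = 1}"
  proof clarify
    fix A assume A: "A \<in> SL2" "A ^\<^sub>m n = 1\<^sub>m 2"
    obtain p q r s where *: "A = mat2 p q r s" "p * s - q * r = 1" using A(1) by (rule SL2_cases)
    obtain l where l: "l \<noteq> 0" "p + s = l + 1 / l" using ex_eigenvalue by blast
    have "l ^ n + 1 / l ^ n = 2"
      using tr2_pow[OF *(2) l(2,1), of n] A(2) *(1) by (simp add: one_mat_2)
    then have "(l ^ n - 1)\<^sup>2 = 0" using l(1) by (simp add: field_simps power2_eq_square)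
    then have "l ^ n = 1" by simp
    then show "tr2 A \<in> (\<lambda>l. l + 1 / l) ` {l. l ^ n = 1}" using l *(1) by auto
  qed
qed

text \<open>The eigenvalues are roots of unity, so of modulus 1. In contrapositive form, an element
  with trace of modulus above 2 has infinite order even up to sign.\<close>

lemma mat2_pow_eq_sign:
  assumes "p * s - q * r = 1" "mat2 p q r s ^\<^sub>m n = e \<cdot>\<^sub>m 1\<^sub>m 2" "e\<^sup>2 = 1" "n > 0"
  shows "cmod (p + s) \<le> 2"
proof -
  obtain l where l: "l \<noteq> 0" "p + s = l + 1 / l" using ex_eigenvalue by blast
  have "l ^ n + 1 / l ^ n = 2 * e"
    using tr2_pow[OF assms(1) l(2,1), of n] assms(2) by (simp add: one_mat_2)
  then have "(l ^ n)\<^sup>2 + 1 = 2 * e * l ^ n" using l(1) by (simp add: field_simps power2_eq_square)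
  then have "(l ^ n - e)\<^sup>2 = 0" using assms(3) by (simp add: power2_diff algebra_simps)
  then have "l ^ n = e" by simp
  moreover have "cmod e = 1" using assms(3) by (metis norm_one norm_power power2_eq_1_iff norm_minus_cancel)
  ultimately have "cmod l ^ n = 1" by (simp flip: norm_power)
  then have "cmod l = 1" using assms(4) power_eq_iff_eq_base[of n "cmod l" 1] by simp
  then show ?thesis using norm_triangle_ineq[of l "1 / l"] l(2) by (simp add: norm_divide)
qed


section \<open>Evaluation of words\<close>

lemma concat_replicate_snoc: "concat (replicate k w) @ w = w @ concat (replicate k w)"
  by (induction k) auto

lemma concat_replicate_singleton: "concat (replicate k [x]) = replicate k x"
  by (induction k) auto

text \<open>The map \<open>h\<close> is kept abstract to cover both \<open>word_eval g\<close> and a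
  homomorphism composed with \<open>pres_class\<close>.\<close>

lemma word_hom_power:
  assumes "h [] = 1\<^sub>m n" "\<And>u v. h (u @ v) = h u * h v" "h w \<in> carrier_mat n n"
  shows "h (concat (replicate k w)) = h w ^\<^sub>m k"
proof (induction k)
  case (Suc k)
  have "h (concat (replicate (Suc k) w)) = h (concat (replicate k w) @ w)"
    by (simp add: concat_replicate_snoc)
  then show ?case by (simp add: assms(2) Suc.IH)
qed (use assms in auto)

lemma presented_group_pow:
  "pres_class R w [^]\<^bsub>presented_group R\<^esub> k = pres_class R (concat (replicate k w))"
proof (induction k)
  case 0
  show ?case by (simp add: nat_pow_def presented_group_def)
next
  case (Suc k)
  have "pres_class R w [^]\<^bsub>presented_group R\<^esub> Suc k =
    pres_class R (concat (replicate k w)) \<otimes>\<^bsub>presented_group R\<^esub> pres_class R w"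
    by (simp add: nat_pow_def flip: Suc.IH)
  then show ?case by (simp add: presented_group_mult concat_replicate_snoc)
qed

definition letter_eval :: "('x \<Rightarrow> complex mat) \<Rightarrow> 'x \<times> bool \<Rightarrow> complex mat" where
  "letter_eval g l = (if snd l then g (fst l) else inv\<^bsub>SL2_group\<^esub> (g (fst l)))"

definition word_eval :: "('x \<Rightarrow> complex mat) \<Rightarrow> 'x word \<Rightarrow> complex mat" where
  "word_eval g w = foldr (\<lambda>l A. letter_eval g l * A) w (1\<^sub>m 2)"

context
  fixes g :: "'x \<Rightarrow> complex mat"
  assumes g: "\<And>x. g x \<in> SL2"
begin

lemma letter_eval_SL2: "letter_eval g l \<in> SL2"
  using g group.inv_closed[OF group_SL2] by (auto simp: letter_eval_def)

lemma letter_eval_cancel: "letter_eval g (x, e) * letter_eval g (x, \<not> e) = 1\<^sub>m 2"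
  using group.r_inv[OF group_SL2, of "g x"] group.l_inv[OF group_SL2, of "g x"] g
  by (cases e) (auto simp: letter_eval_def)

lemma word_eval_SL2: "word_eval g w \<in> SL2"
proof (induction w)
  case Nil
  show ?case by (simp add: word_eval_def one_mat_2)
next
  case (Cons l w)
  then show ?case using SL2_mult[OF letter_eval_SL2] by (simp add: word_eval_def)
qed

lemma word_eval_carrier: "word_eval g w \<in> carrier_mat 2 2"
  using word_eval_SL2 SL2_subset_GL carrier_GL_subset by blast

lemma letter_eval_carrier: "letter_eval g w \<in> carrier_mat 2 2"
  using letter_eval_SL2 SL2_subset_GL carrier_GL_subset by blast

lemma word_eval_append: "word_eval g (u @ v) = word_eval g u * word_eval g v"
proof (induction u)
  case Nil
  show ?case using left_mult_one_mat[OF word_eval_carrier] by (simp add: word_eval_def)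
next
  case (Cons l u)
  have "word_eval g ((l # u) @ v) = letter_eval g l * (word_eval g u * word_eval g v)"
    using Cons.IH by (simp add: word_eval_def)
  also have "\<dots> = letter_eval g l * word_eval g u * word_eval g v"
    by (rule assoc_mult_mat[symmetric]) (rule letter_eval_carrier word_eval_carrier)+
  finally show ?case by (simp add: word_eval_def)
qed

lemma word_eval_Nil: "word_eval g [] = 1\<^sub>m 2"
  by (simp add: word_eval_def)

lemma word_eval_single: "word_eval g [l] = letter_eval g l"
  using right_mult_one_mat[OF letter_eval_carrier] by (simp add: word_eval_def)

text \<open>Scalar matrices are central, so the sign of a relator can be pulled out of the middle of
  a word.\<close>

lemma word_eval_insert:
  assumes "word_eval g r = e \<cdot>\<^sub>m 1\<^sub>m 2"
  shows "word_eval g (u @ r @ v) = e \<cdot>\<^sub>m word_eval g (u @ v)"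
proof -
  obtain p q s t where u: "word_eval g u = mat2 p q s t" using mat2_cases word_eval_carrier by metis
  obtain p' q' s' t' where v: "word_eval g v = mat2 p' q' s' t'"
    using mat2_cases word_eval_carrier by metis
  show ?thesis by (simp add: word_eval_append u v assms one_mat_2 algebra_simps)
qed

text \<open>Relations up to sign suffice, so that \<open>PSL\<^sub>2\<close> is never needed as a group.\<close>

lemma pres_eq_word_eval:
  assumes rel: "\<And>r. r \<in> R \<Longrightarrow> \<exists>e. e\<^sup>2 = 1 \<and> word_eval g r = e \<cdot>\<^sub>m 1\<^sub>m 2"
    and "pres_eq R u v"
  shows "\<exists>e. e\<^sup>2 = 1 \<and> word_eval g u = e \<cdot>\<^sub>m word_eval g v"
  using assms(2)
proof induction
  case (refl u)
  obtain p q s t where "word_eval g u = mat2 p q s t" using mat2_cases word_eval_carrier by metis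
  then show ?case by (intro exI[of _ 1]) simp
next
  case (sym u v)
  then obtain e where e: "e\<^sup>2 = 1" "word_eval g u = e \<cdot>\<^sub>m word_eval g v" by blast
  obtain p q s t where v: "word_eval g v = mat2 p q s t" using mat2_cases word_eval_carrier by metis
  \<comment> \<open>As \<open>e * e = 1\<close>, scaling by the same sign undoes itself.\<close>
  show ?case using e by (intro exI[of _ e]) (simp add: v power2_eq_square flip: mult.assoc)
next
  case (trans u v w)
  then obtain e e' where e: "e\<^sup>2 = 1" "word_eval g u = e \<cdot>\<^sub>m word_eval g v"
    "e'\<^sup>2 = 1" "word_eval g v = e' \<cdot>\<^sub>m word_eval g w" by blast
  obtain p q s t where w: "word_eval g w = mat2 p q s t" using mat2_cases word_eval_carrier by metis
  show ?case using e by (intro exI[of _ "e * e'"]) (simp add: w power_mult_distrib mult.assoc)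
next
  case (cancel u x e v)
  have "word_eval g [(x, e), (x, \<not> e)] = 1 \<cdot>\<^sub>m 1\<^sub>m 2"
    using word_eval_append[of "[(x, e)]" "[(x, \<not> e)]"]
    by (simp add: word_eval_single letter_eval_cancel one_mat_2)
  then show ?case using word_eval_insert by (metis power_one)
next
  case (relator r u v)
  then show ?case using rel word_eval_insert by metis
qed

end

section \<open>Von Dyck groups\<close>

definition dyck_relators :: "nat \<Rightarrow> nat \<Rightarrow> nat \<Rightarrow> dyck_gen word set" where
  "dyck_relators a b c =
     {replicate a (X1, True), replicate b (X2, True), replicate c (X3, True),
      [(X1, True), (X2, True), (X3, True)]}"

lemma von_dyck_group_eq: "von_dyck_group a b c = presented_group (dyck_relators a b c)"
  by (simp add: von_dyck_group_def dyck_relators_def)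

definition dyck_commutator :: "dyck_gen word" where
  "dyck_commutator = [(X1, True), (X2, True), (X1, False), (X2, False)]"

section \<open>Matrices for the hyperbolic triangle group and the order of the commutator\<close>

text \<open>An angle sum below pi makes cos \<gamma> larger than cos (pi - \<alpha> - \<beta>) = sin
  \<alpha> sin \<beta> - cos \<alpha> cos \<beta>; squaring the resulting inequality of positive
  numbers gives the claim. An angle sum of pi would give equality.\<close>

lemma triangle_cos_ineq:
  fixes \<alpha> \<beta> \<gamma> :: real
  assumes "\<alpha> > 0" "\<beta> > 0" "\<gamma> > 0" "\<alpha> + \<beta> + \<gamma> < pi"
  shows "1 < (cos \<alpha>)\<^sup>2 + (cos \<beta>)\<^sup>2 + (cos \<gamma>)\<^sup>2 + 2 * cos \<alpha> * cos \<beta> * cos \<gamma>"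
proof -
  have "cos (pi - (\<alpha> + \<beta>)) < cos \<gamma>" using assms by (intro cos_monotone_0_pi) auto
  then have *: "sin \<alpha> * sin \<beta> < cos \<gamma> + cos \<alpha> * cos \<beta>" by (simp add: cos_add)
  have "sin \<alpha> * sin \<beta> > 0" using assms by (intro mult_pos_pos sin_gt_zero) auto
  then have "(sin \<alpha> * sin \<beta>)\<^sup>2 < (cos \<gamma> + cos \<alpha> * cos \<beta>)\<^sup>2"
    using * by (intro power_strict_mono) auto
  moreover have "(sin \<alpha> * sin \<beta>)\<^sup>2 = (1 - (cos \<alpha>)\<^sup>2) * (1 - (cos \<beta>)\<^sup>2)"
    by (simp add: power_mult_distrib sin_squared_eq)
  ultimately show ?thesis by (simp add: power2_sum power_mult_distrib algebra_simps)
qed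

lemma cis_add_inverse: "cis \<theta> + 1 / cis \<theta> = of_real (2 * cos \<theta>)"
  by (simp add: complex_eq_iff cis_divide flip: cis_inverse inverse_eq_divide)

text \<open>These are the eigenvalue conditions of \<open>mat2_pow_scalar\<close> with sign -1. For
  \<open>n = 1\<close> the second one fails, because cis pi = -1.\<close>

lemma cis_pi_over:
  assumes "n \<ge> (2 :: nat)"
  shows "cis (pi / n) ^ n = - 1" "(cis (pi / n))\<^sup>2 \<noteq> 1"
proof -
  show "cis (pi / n) ^ n = - 1" using assms by (simp add: DeMoivre)
  have "pi * 2 \<le> pi * n" using assms by (intro mult_left_mono) auto
  then have "2 * (pi / n) \<le> pi" using assms by (simp add: field_simps)
  then have "cos (2 * (pi / n)) < cos 0" using assms by (intro cos_monotone_0_pi) auto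
  moreover have "Re ((cis (pi / n))\<^sup>2) = cos (2 * (pi / n))" by (simp add: DeMoivre)
  ultimately show "(cis (pi / n))\<^sup>2 \<noteq> 1" by auto
qed

text \<open>An upper and a lower triangular matrix carry the prescribed eigenvalues, and the free
  entry of the second adjusts the trace of the product. The negative trace of \<open>A * B\<close>
  makes the cubic term of Fricke's identity enter with the sign required by
  \<open>triangle_cos_ineq\<close>.\<close>

lemma triangle_matrices:
  assumes "a \<ge> 2" "b \<ge> 2" "c \<ge> (2 :: nat)"
  obtains A B C e where "A \<in> SL2" "B \<in> SL2" "C \<in> SL2" "A * B * C = 1\<^sub>m 2"
    "A ^\<^sub>m a = - 1 \<cdot>\<^sub>m 1\<^sub>m 2" "B ^\<^sub>m b = - 1 \<cdot>\<^sub>m 1\<^sub>m 2" "C ^\<^sub>m c = e \<cdot>\<^sub>m 1\<^sub>m 2" "e\<^sup>2 = 1"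
    "tr2 A = of_real (2 * cos (pi / a))" "tr2 B = of_real (2 * cos (pi / b))"
    "tr2 (A * B) = of_real (- 2 * cos (pi / c))"
proof -
  define l m n where "l = cis (pi / a)" and "m = cis (pi / b)" and "n = cis (pi / c)"
  have nz: "l \<noteq> 0" "m \<noteq> 0" "n \<noteq> 0" by (simp_all add: l_def m_def n_def)
  \<comment> \<open>This solves l m + r + 1 / (l m) = -(n + 1 / n), the trace condition on
    \<open>A * B\<close>.\<close>
  define r where "r = - (n + 1 / n) - l * m - 1 / (l * m)"
  define A where "A = mat2 l 1 0 (1 / l)"
  define B where "B = mat2 m 0 r (1 / m)"
  define C where "C = mat2 (1 / (l * m)) (- (1 / m)) (- (r / l)) (l * m + r)"
  have AB: "A * B = mat2 (l * m + r) (1 / m) (r / l) (1 / (l * m))"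
    by (simp add: A_def B_def)
  have det: "(l * m + r) * (1 / (l * m)) - 1 / m * (r / l) = 1"
    using nz by (simp add: field_simps)
  show thesis
  proof (rule that)
    show "A \<in> SL2" "B \<in> SL2" using nz by (simp_all add: A_def B_def)
    show "C \<in> SL2" using det by (simp add: C_def algebra_simps)
    show "A * B * C = 1\<^sub>m 2" unfolding AB C_def by (rule mat2_inverse(2)[OF det])
    show "A ^\<^sub>m a = - 1 \<cdot>\<^sub>m 1\<^sub>m 2" unfolding A_def
      by (rule mat2_pow_scalar[of _ _ _ _ l])
        (use nz cis_pi_over[OF assms(1)] in \<open>simp_all add: l_def\<close>)
    show "B ^\<^sub>m b = - 1 \<cdot>\<^sub>m 1\<^sub>m 2" unfolding B_def
      by (rule mat2_pow_scalar[of _ _ _ _ m])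
        (use nz cis_pi_over[OF assms(2)] in \<open>simp_all add: m_def\<close>)
    \<comment> \<open>The eigenvalues of \<open>C\<close> are -n and -1/n, and n^c = -1, so the sign
      is (-1)^(c + 1); its dependence on the parity of \<open>c\<close> is why the statement has an
      unspecified \<open>e\<close>.\<close>
    show "C ^\<^sub>m c = ((- n) ^ c) \<cdot>\<^sub>m 1\<^sub>m 2" unfolding C_def
    proof (rule mat2_pow_scalar[of _ _ _ _ "- n"])
      show "1 / (l * m) * (l * m + r) - - (1 / m) * - (r / l) = 1"
        using det by (simp add: algebra_simps)
      show "((- n) ^ c)\<^sup>2 = 1"
        using cis_pi_over(1)[OF assms(3)] by (simp add: n_def power_minus[of "cis _"] power_mult_distrib flip: power_mult)
    qed (use nz cis_pi_over(2)[OF assms(3)] in \<open>simp_all add: n_def r_def\<close>)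
    show "((- n) ^ c)\<^sup>2 = 1"
      using cis_pi_over(1)[OF assms(3)] by (simp add: n_def power_minus[of "cis _"] power_mult_distrib flip: power_mult)
    show "tr2 A = of_real (2 * cos (pi / a))"
      using cis_add_inverse[of "pi / a"] by (simp add: A_def l_def)
    show "tr2 B = of_real (2 * cos (pi / b))"
      using cis_add_inverse[of "pi / b"] by (simp add: B_def m_def)
    show "tr2 (A * B) = of_real (- 2 * cos (pi / c))"
      using cis_add_inverse[of "pi / c"] by (simp add: AB r_def n_def)
  qed
qed

text \<open>If a positive power were trivial, evaluation at the triangle matrices would give a power
  equal to plus or minus the identity, hence trace of modulus at most 2. But the trace is 4 X - 2
  with X > 1 by \<open>triangle_cos_ineq\<close>.\<close>

lemma dyck_commutator_infinite_order:
  fixes a b c k :: nat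
  assumes "a > 0" "b > 0" "c > 0" "1 / real a + 1 / real b + 1 / real c < 1" "k > 0"
  shows "pres_class (dyck_relators a b c) dyck_commutator [^]\<^bsub>von_dyck_group a b c\<^esub> k
    \<noteq> \<one>\<^bsub>von_dyck_group a b c\<^esub>"
proof
  let ?R = "dyck_relators a b c"
  assume "pres_class ?R dyck_commutator [^]\<^bsub>von_dyck_group a b c\<^esub> k = \<one>\<^bsub>von_dyck_group a b c\<^esub>"
  then have trivial: "pres_eq ?R (concat (replicate k dyck_commutator)) []"
    unfolding von_dyck_group_eq presented_group_pow
    by (simp add: presented_group_def pres_class_eq_iff)
  have pos: "1 / real a > 0" "1 / real b > 0" "1 / real c > 0" using assms by auto
  with assms(4) have "1 / real a < 1" "1 / real b < 1" "1 / real c < 1" by linarith+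
  \<comment> \<open>Each reciprocal lies strictly below 1 because the other two are
    positive.\<close>
  then have "a \<ge> 2" "b \<ge> 2" "c \<ge> 2" using assms(1-3) by (auto simp: field_simps)
  then obtain A B C e where M: "A \<in> SL2" "B \<in> SL2" "C \<in> SL2" "A * B * C = 1\<^sub>m 2"
    "A ^\<^sub>m a = - 1 \<cdot>\<^sub>m 1\<^sub>m 2" "B ^\<^sub>m b = - 1 \<cdot>\<^sub>m 1\<^sub>m 2" "C ^\<^sub>m c = e \<cdot>\<^sub>m 1\<^sub>m 2" "e\<^sup>2 = 1"
    "tr2 A = of_real (2 * cos (pi / a))" "tr2 B = of_real (2 * cos (pi / b))"
    "tr2 (A * B) = of_real (- 2 * cos (pi / c))"
    by (rule triangle_matrices) blast
  define g where "g = case_dyck_gen A B C"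
  have g: "g x \<in> SL2" for x using M by (cases x) (auto simp: g_def)
  note ev = word_eval_append[of g, OF g] word_eval_single[of g, OF g]
  note power = word_hom_power[of "word_eval g", OF word_eval_Nil[of g, OF g] ev(1) word_eval_carrier[of g, OF g]]
  have letters: "letter_eval g (X1, True) = A" "letter_eval g (X2, True) = B"
    "letter_eval g (X3, True) = C"
    by (simp_all add: letter_eval_def g_def)
  have gen_power: "word_eval g (replicate n x) = letter_eval g x ^\<^sub>m n" for n x
    using power[of n "[x]"] by (simp add: concat_replicate_singleton ev(2))
  have "\<exists>e. e\<^sup>2 = 1 \<and> word_eval g r = e \<cdot>\<^sub>m 1\<^sub>m 2" if r: "r \<in> ?R" for r
  proof -
    consider "r = replicate a (X1, True)" | "r = replicate b (X2, True)"
      | "r = replicate c (X3, True)" | "r = [(X1, True), (X2, True), (X3, True)]"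
      using r unfolding dyck_relators_def by blast
    then show ?thesis
    proof cases
      case 4
      have carrier: "A \<in> carrier_mat 2 2" "B \<in> carrier_mat 2 2" "C \<in> carrier_mat 2 2"
        using M SL2_subset_GL carrier_GL_subset by blast+
      have "r = [(X1, True)] @ [(X2, True)] @ [(X3, True)]" using 4 by simp
      then have "word_eval g r = A * (B * C)" by (simp only: ev letters)
      then have "word_eval g r = 1\<^sub>m 2" using M(4) assoc_mult_mat[OF carrier] by simp
      then show ?thesis by (intro exI[of _ 1]) (simp add: one_mat_2)
    qed (use M in \<open>auto simp: gen_power letters intro: exI[of _ "- 1"] exI[of _ e]\<close>)
  qed
  then obtain e' where e': "e'\<^sup>2 = 1"
    "word_eval g (concat (replicate k dyck_commutator)) = e' \<cdot>\<^sub>m word_eval g []"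
    using pres_eq_word_eval[of g, OF g _ trivial] by blast
  have D: "word_eval g dyck_commutator \<in> SL2" by (rule word_eval_SL2[of g, OF g])
  then obtain p q r s where pqrs: "word_eval g dyck_commutator = mat2 p q r s" "p * s - q * r = 1"
    by (rule SL2_cases)
  have "mat2 p q r s ^\<^sub>m k = e' \<cdot>\<^sub>m 1\<^sub>m 2"
    using e'(2) by (simp add: power pqrs(1) word_eval_Nil[of g, OF g])
  from mat2_pow_eq_sign[OF pqrs(2) this e'(1) assms(5)]
  have le: "cmod (tr2 (word_eval g dyck_commutator)) \<le> 2" by (simp add: pqrs(1))
  let ?A' = "letter_eval g (X1, False)" and ?B' = "letter_eval g (X2, False)"
  have "word_eval g dyck_commutator = word_eval g ((([(X1, True)] @ [(X2, True)]) @ [(X1, False)]) @ [(X2, False)])"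
    by (simp add: dyck_commutator_def)
  then have "word_eval g dyck_commutator = A * B * ?A' * ?B'" by (simp only: ev letters)
  then have "tr2 (word_eval g dyck_commutator) =
    (tr2 A)\<^sup>2 + (tr2 B)\<^sup>2 + (tr2 (A * B))\<^sup>2 - tr2 A * tr2 B * tr2 (A * B) - 2"
    using tr2_commutator[OF M(1,2) letter_eval_SL2[of g, OF g] letter_eval_SL2[of g, OF g]]
      letter_eval_cancel[of g X1 True, OF g] letter_eval_cancel[of g X2 True, OF g]
    by (simp add: letters)
  also have "\<dots> = of_real (4 * ((cos (pi / a))\<^sup>2 + (cos (pi / b))\<^sup>2 + (cos (pi / c))\<^sup>2 +
      2 * cos (pi / a) * cos (pi / b) * cos (pi / c)) - 2)"
    by (simp add: M(9-11) power2_eq_square algebra_simps)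
  finally have tr: "tr2 (word_eval g dyck_commutator) = \<dots>" .
  have "pi * (1 / real a + 1 / real b + 1 / real c) < pi * 1"
    using assms(4) by (intro mult_strict_left_mono) auto
  then have "pi / a + pi / b + pi / c < pi" by (simp add: algebra_simps)
  then have "1 < (cos (pi / a))\<^sup>2 + (cos (pi / b))\<^sup>2 + (cos (pi / c))\<^sup>2 +
      2 * cos (pi / a) * cos (pi / b) * cos (pi / c)"
    using assms by (intro triangle_cos_ineq) auto
  moreover have "\<not> \<bar>4 * X - 2\<bar> \<le> 2" if "1 < X" for X :: real using that by linarith
  ultimately show False using le unfolding tr norm_of_real by blast
qed

section \<open>Homomorphisms to SL2 and the failure of Borel's property\<close>

text \<open>The witnesses are the images of the three generators. Replacing the trace of
  \<open>A * B\<close> by that of \<open>C\<close> expresses Fricke's identity through traces of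
  torsion elements only.\<close>

lemma von_dyck_hom_commutator_trace:
  assumes "\<phi> \<in> hom (von_dyck_group a b c) SL2_group"
  shows "\<exists>A B C. A \<in> SL2 \<and> B \<in> SL2 \<and> C \<in> SL2 \<and>
    A ^\<^sub>m a = 1\<^sub>m 2 \<and> B ^\<^sub>m b = 1\<^sub>m 2 \<and> C ^\<^sub>m c = 1\<^sub>m 2 \<and>
    \<phi> (pres_class (dyck_relators a b c) dyck_commutator) \<in> SL2 \<and>
    tr2 (\<phi> (pres_class (dyck_relators a b c) dyck_commutator)) =
      (tr2 A)\<^sup>2 + (tr2 B)\<^sup>2 + (tr2 C)\<^sup>2 - tr2 A * tr2 B * tr2 C - 2"
proof -
  let ?R = "dyck_relators a b c"
  define h where "h w = \<phi> (pres_class ?R w)" for w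
  have hom: "\<phi> \<in> hom (presented_group ?R) SL2_group"
    using assms by (simp add: von_dyck_group_eq)
  have carrier: "pres_class ?R w \<in> carrier (presented_group ?R)" for w
    by (simp add: presented_group_def)
  have SL2: "h w \<in> SL2" for w using hom_in_carrier[OF hom carrier] by (simp add: h_def)
  have mult: "h (u @ v) = h u * h v" for u v
    using hom_mult[OF hom carrier carrier] by (simp add: h_def presented_group_mult)
  have one: "h [] = 1\<^sub>m 2"
    using hom_one[OF hom group_presented_group group_SL2] by (simp add: h_def presented_group_def)
  have matrix: "h w \<in> carrier_mat 2 2" for w
    using SL2 SL2_subset_GL carrier_GL_subset by blast
  have relator: "h r = 1\<^sub>m 2" if "r \<in> ?R" for r
    using pres_eq.relator[OF that, of "[]" "[]"] one
    by (simp add: h_def flip: pres_class_eq_iff)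
  have inverse: "h [(x, True)] * h [(x, False)] = 1\<^sub>m 2" for x
    using pres_eq.cancel[of ?R "[]" x True "[]"] one
    by (simp add: h_def flip: mult[unfolded h_def] pres_class_eq_iff)
  have torsion: "h [(x, True)] ^\<^sub>m n = 1\<^sub>m 2" if "replicate n (x, True) \<in> ?R" for x n
    using word_hom_power[of h, OF one mult matrix, of n "[(x, True)]"] relator[OF that]
    by (simp add: concat_replicate_singleton)
  let ?A = "h [(X1, True)]" and ?B = "h [(X2, True)]" and ?C = "h [(X3, True)]"
  have "?A * ?B * ?C = 1\<^sub>m 2"
    using relator[of "[(X1, True), (X2, True), (X3, True)]"]
    by (simp add: dyck_relators_def flip: mult)
  then have "tr2 ?C = tr2 (?A * ?B)"
    using SL2 SL2_mult by (intro SL2_right_inverse_trace) auto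
  moreover have "h dyck_commutator = ?A * ?B * h [(X1, False)] * h [(X2, False)]"
    by (simp add: dyck_commutator_def flip: mult)
  ultimately have "tr2 (h dyck_commutator) =
      (tr2 ?A)\<^sup>2 + (tr2 ?B)\<^sup>2 + (tr2 ?C)\<^sup>2 - tr2 ?A * tr2 ?B * tr2 ?C - 2"
    using tr2_commutator[OF SL2 SL2 SL2 SL2 inverse inverse] by simp
  moreover have "?A ^\<^sub>m a = 1\<^sub>m 2" "?B ^\<^sub>m b = 1\<^sub>m 2" "?C ^\<^sub>m c = 1\<^sub>m 2"
    by (intro torsion; simp add: dyck_relators_def)+
  ultimately show ?thesis using SL2 unfolding h_def by blast
qed

theorem theorem1p7:
  fixes a b c :: nat
  assumes "a > 0" and "b > 0" and "c > 0"
    and "1 / real a + 1 / real b + 1 / real c < 1"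
  shows "\<not> borel_property (von_dyck_group a b c)"
proof
  assume borel: "borel_property (von_dyck_group a b c)"
  let ?X = "\<lambda>n. {tr2 A | A. A \<in> SL2 \<and> A ^\<^sub>m n = 1\<^sub>m 2}"
  let ?\<gamma> = "pres_class (dyck_relators a b c) dyck_commutator"
  \<comment> \<open>The set depends only on the exponents: it holds the values of Fricke's
    polynomial at all possible torsion traces, whatever the homomorphism.\<close>
  define T where "T = (\<lambda>(x, y, z). x\<^sup>2 + y\<^sup>2 + z\<^sup>2 - x * y * z - 2) ` (?X a \<times> ?X b \<times> ?X c)"
  define V where "V = {A \<in> SL2. tr2 A \<in> T}"
  have "finite T"
    unfolding T_def using assms by (intro finite_imageI finite_cartesian_product finite_torsion_traces)
  then have closed: "closedin (zariski 2) V" unfolding V_def by (rule closedin_SL2_trace)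
  obtain t where "t \<notin> T" using \<open>finite T\<close> ex_new_if_finite infinite_UNIV_char_0 by blast
  \<comment> \<open>The companion matrix of X^2 - t X + 1 realises any trace in SL2, so a value
    outside \<open>T\<close> shows that \<open>V\<close> is proper.\<close>
  then have "mat2 0 (- 1) 1 t \<in> SL2 - V" by (simp add: V_def)
  moreover have "V \<subseteq> SL2" by (auto simp: V_def)
  ultimately have "V \<subset> SL2" by blast
  note closed this
  moreover have "?\<gamma> \<in> carrier (von_dyck_group a b c)"
    by (simp add: von_dyck_group_eq presented_group_def)
  moreover have order: "?\<gamma> [^]\<^bsub>von_dyck_group a b c\<^esub> k \<noteq> \<one>\<^bsub>von_dyck_group a b c\<^esub>" if "k > 0" for k :: nat
    using dyck_commutator_infinite_order[OF assms that] .
  moreover have "?\<gamma> \<noteq> \<one>\<^bsub>von_dyck_group a b c\<^esub>"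
    using order[of 1] presented_group_pow[of _ dyck_commutator 1] by (simp add: von_dyck_group_eq)
  ultimately obtain \<phi> where \<phi>: "\<phi> \<in> hom (von_dyck_group a b c) SL2_group" "\<phi> ?\<gamma> \<notin> V"
    using borel connected_semisimple_SL2 unfolding borel_property_def by blast
  obtain A B C where "A \<in> SL2" "B \<in> SL2" "C \<in> SL2"
    "A ^\<^sub>m a = 1\<^sub>m 2" "B ^\<^sub>m b = 1\<^sub>m 2" "C ^\<^sub>m c = 1\<^sub>m 2" and \<gamma>: "\<phi> ?\<gamma> \<in> SL2"
    "tr2 (\<phi> ?\<gamma>) = (tr2 A)\<^sup>2 + (tr2 B)\<^sup>2 + (tr2 C)\<^sup>2 - tr2 A * tr2 B * tr2 C - 2"
    using von_dyck_hom_commutator_trace[OF \<phi>(1)] by blast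
  then have "(tr2 A, tr2 B, tr2 C) \<in> ?X a \<times> ?X b \<times> ?X c" by blast
  then have "tr2 (\<phi> ?\<gamma>) \<in> T" unfolding T_def \<gamma>(2) by (rule rev_image_eqI) simp
  then show False using \<phi>(2) \<gamma>(1) by (simp add: V_def)
qed

end
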